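(* Suppose the MLE is consistent and Wilks' theorem holds under every $P\in\mathcal{Q}$ (that is, $2\alpha_{\mathcal{Q}|\mathbf{x}_N}(P)$ is asymptotically $\chi^2_d$ distributed under $P$, where $d$ is a known parameter). Let $k>0$. Then, for a random variable $\xi$, $$\mathcal{I}_N(\xi)=\Big[-\mathcal{E}^{k,\infty}_{\mathcal{Q}|\mathbf{x}_N}(-\xi),\ \mathcal{E}^{k,\infty}_{\mathcal{Q}|\mathbf{x}_N}(\xi)\Big]$$ is a likelihood interval for $E[\xi]$, i.e. its endpoints are the infimum and supremum of $E_Q[\xi|\mathbf{x}_N]$ over those $Q\in\mathcal{Q}$ whose likelihood relative to the maximum likelihood is at least $e^{-k}$; and it has the uniform asymptotic property that, for every $P\in\mathcal{Q}$, $$\liminf_{N\to\infty}P\Big(E_P[\xi|\mathbf{x}_N]\in\mathcal{I}_N(\xi)\text{ for all }\xi\Big)\ge F_{\chi^2_d}(2k),$$ where $F_{\chi^2_d}$ is the cumulative distribution function of the $\chi^2_d$ distribution.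
   Context: Setting. $\mathcal{Q}$ is a family of probability measures, parameterized by a finite-dimensional parameter $\theta$, on a measurable space carrying real random variables $X,X_1,X_2,\dots$; under each $Q\in\mathcal{Q}$, $X,\{X_n\}_{n\in\mathbb{N}}$ are iid with density $f(\cdot;Q)$. Write $\mathbf{x}_N=(X_1,\dots,X_N)$, $L(Q|\mathbf{x}_N)=\prod_{n=1}^N f(X_n;Q)$. The MLE $\hat Q_N\in\mathcal{Q}$ is a maximizer of $L(\cdot|\mathbf{x}_N)$; consistency means that for every $Q\in\mathcal{Q}$ the maximizer exists with $Q$-probability tending to $1$ and its parameter converges in $Q$-probability to the parameter of $Q$. Divergence: $\alpha_{\mathcal{Q}|\mathbf{x}_N}(Q)=-\log L(Q|\mathbf{x}_N)+\sup_{\tilde Q\in\mathcal{Q}}\log L(\tilde Q|\mathbf{x}_N)$ (the negative log of the likelihood relative to the maximum). DR-expectation with $\gamma=\infty$: $\mathcal{E}^{k,\infty}_{\mathcal{Q}|\mathbf{x}_N}(\xi)=\sup_{Q\in\mathcal{Q}}\{E_Q[\xi|\mathbf{x}_N]-(\frac1k\alpha_{\mathcal{Q}|\mathbf{x}_N}(Q))^\infty\}$ with the convention $x^\infty=0$ for $x\in[0,1]$ and $x^\infty=+\infty$ for $x>1$. The random variables $\xi$ are those for which the conditional expectations $E_Q[\xi|\mathbf{x}_N]$, $Q\in\mathcal{Q}$, are defined (a version is fixed for each $Q$ and $\xi$, with $E_Q[-\xi|\mathbf{x}_N]=-E_Q[\xi|\mathbf{x}_N]$); they need not be bounded nor independent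 of the observations. If the event "for all $\xi$" is not measurable, its probability is understood as inner probability. *)

theory Defs
  imports "HOL-Probability.Probability"
begin

text \<open>
  The measure \<open>\<Omega>\<close> only supplies the measurable space on which all members of \<open>\<Q>\<close> live. The map
  \<open>param\<close> sends \<open>Q \<in> \<Q>\<close> to its finite-dimensional parameter. The variable \<open>X 0\<close> is the generic
  copy \<open>X\<close>, and \<open>X 1, X 2, \<dots>\<close> are the observations. Densities are taken with respect to a
  \<open>\<sigma>\<close>-finite measure \<open>\<mu>\<close> on the line which is common to the family (for instance \<open>lborel\<close>).
\<close>

locale iid_family =
  fixes \<Omega> :: "'a measure" and \<mu> :: "real measure" and \<Q> :: "'a measure set"
    and param :: "'a measure \<Rightarrow> 'p::euclidean_space"
    and X :: "nat \<Rightarrow> 'a \<Rightarrow> real" and f :: "'a measure \<Rightarrow> real \<Rightarrow> real"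
  assumes prob_space: "Q \<in> \<Q> \<Longrightarrow> prob_space Q"
    and sets_eq: "Q \<in> \<Q> \<Longrightarrow> sets Q = sets \<Omega>"
    and inj_param: "inj_on param \<Q>"
    and sigma_finite_ref: "sigma_finite_measure \<mu>"
    and sets_ref: "sets \<mu> = sets borel"
    and density_nonneg: "Q \<in> \<Q> \<Longrightarrow> 0 \<le> f Q t"
    and density: "Q \<in> \<Q> \<Longrightarrow> distributed Q \<mu> (X n) (\<lambda>t. ennreal (f Q t))"
    and indep: "Q \<in> \<Q> \<Longrightarrow> prob_space.indep_vars Q (\<lambda>_. borel) X UNIV"

text \<open>The observation vector \<open>(X\<^sub>1, \<dots>, X\<^sub>N)\<close> and the \<open>\<sigma>\<close>-algebra it generates.\<close>

definition obs :: "(nat \<Rightarrow> 'a \<Rightarrow> real) \<Rightarrow> nat \<Rightarrow> 'a \<Rightarrow> nat \<Rightarrow> real" where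
  "obs X N \<omega> = (\<lambda>n\<in>{1..N}. X n \<omega>)"

definition obs_algebra :: "'a measure \<Rightarrow> (nat \<Rightarrow> 'a \<Rightarrow> real) \<Rightarrow> nat \<Rightarrow> 'a measure" where
  "obs_algebra \<Omega> X N = vimage_algebra (space \<Omega>) (obs X N) (PiM {1..N} (\<lambda>_. borel))"

text \<open>
  Below, \<open>x\<close> is the vector of observed values and \<open>N\<close> the sample size. The log-likelihood and the
  divergence are extended-real valued: \<open>-log 0 = \<infinity>\<close>. In \<open>ereal\<close> one has \<open>\<infinity> + (-\<infinity>) = \<infinity>\<close>, so the
  divergence is \<open>\<infinity>\<close> for all \<open>Q\<close> if all likelihoods vanish; it is also \<open>\<infinity>\<close> for all \<open>Q\<close> if the
  likelihood is unbounded over \<open>\<Q>\<close>.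
\<close>

definition likelihood :: "('a measure \<Rightarrow> real \<Rightarrow> real) \<Rightarrow> nat \<Rightarrow> (nat \<Rightarrow> real) \<Rightarrow> 'a measure \<Rightarrow> real" where
  "likelihood f N x Q = (\<Prod>n=1..N. f Q (x n))"

definition log_likelihood :: "('a measure \<Rightarrow> real \<Rightarrow> real) \<Rightarrow> nat \<Rightarrow> (nat \<Rightarrow> real) \<Rightarrow> 'a measure \<Rightarrow> ereal" where
  "log_likelihood f N x Q =
     (if likelihood f N x Q = 0 then -\<infinity> else ereal (ln (likelihood f N x Q)))"

definition divergence ::
  "'a measure set \<Rightarrow> ('a measure \<Rightarrow> real \<Rightarrow> real) \<Rightarrow> nat \<Rightarrow> (nat \<Rightarrow> real) \<Rightarrow> 'a measure \<Rightarrow> ereal" where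
  "divergence \<Q> f N x Q = - log_likelihood f N x Q + (SUP R\<in>\<Q>. log_likelihood f N x R)"

definition relative_likelihood ::
  "'a measure set \<Rightarrow> ('a measure \<Rightarrow> real \<Rightarrow> real) \<Rightarrow> nat \<Rightarrow> (nat \<Rightarrow> real) \<Rightarrow> 'a measure \<Rightarrow> ereal" where
  "relative_likelihood \<Q> f N x Q =
     ereal (likelihood f N x Q) / (SUP R\<in>\<Q>. ereal (likelihood f N x R))"

text \<open>Inner probability; it agrees with \<open>measure M\<close> on measurable sets.\<close>

definition inner_prob :: "'a measure \<Rightarrow> 'a set \<Rightarrow> real" where
  "inner_prob M A = (SUP B\<in>{B \<in> sets M. B \<subseteq> A}. measure M B)"

lemma inner_prob_eq_measure:
  assumes "finite_measure M" and A: "A \<in> sets M"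
  shows "inner_prob M A = measure M A"
proof -
  interpret finite_measure M by fact
  show ?thesis
    unfolding inner_prob_def
    by (rule cSup_eq_maximum) (use A in \<open>auto intro: finite_measure_mono\<close>)
qed

text \<open>
  \<open>Qhat N x\<close> is a maximum likelihood estimate whenever the likelihood has a maximizer over \<open>\<Q>\<close>, and
  is arbitrary otherwise. In the second clause of consistency this arbitrary value is irrelevant,
  because of the first clause.
\<close>

definition is_MLE ::
  "'a measure set \<Rightarrow> ('a measure \<Rightarrow> real \<Rightarrow> real) \<Rightarrow> (nat \<Rightarrow> (nat \<Rightarrow> real) \<Rightarrow> 'a measure) \<Rightarrow> bool" where
  "is_MLE \<Q> f Qhat \<longleftrightarrow>
     (\<forall>N x. (\<exists>Q. is_arg_max (likelihood f N x) (\<lambda>Q. Q \<in> \<Q>) Q) \<longrightarrow>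
            is_arg_max (likelihood f N x) (\<lambda>Q. Q \<in> \<Q>) (Qhat N x))"

definition consistent_MLE ::
  "'a measure set \<Rightarrow> ('a measure \<Rightarrow> 'p::euclidean_space) \<Rightarrow> (nat \<Rightarrow> 'a \<Rightarrow> real) \<Rightarrow>
   ('a measure \<Rightarrow> real \<Rightarrow> real) \<Rightarrow> (nat \<Rightarrow> (nat \<Rightarrow> real) \<Rightarrow> 'a measure) \<Rightarrow> bool" where
  "consistent_MLE \<Q> param X f Qhat \<longleftrightarrow> is_MLE \<Q> f Qhat \<and>
     (\<forall>Q\<in>\<Q>.
        (\<lambda>N. inner_prob Q {\<omega> \<in> space Q. \<exists>R. is_arg_max (likelihood f N (obs X N \<omega>)) (\<lambda>R. R \<in> \<Q>) R})
          \<longlonglongrightarrow> 1 \<and>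
        (\<forall>\<epsilon>>0. (\<lambda>N. inner_prob Q {\<omega> \<in> space Q. dist (param (Qhat N (obs X N \<omega>))) (param Q) < \<epsilon>})
          \<longlonglongrightarrow> 1))"

definition chi_square_density :: "nat \<Rightarrow> real \<Rightarrow> real" where
  "chi_square_density d x =
     (if x \<le> 0 then 0
      else x powr (real d / 2 - 1) * exp (- x / 2) / (2 powr (real d / 2) * Gamma (real d / 2)))"

definition chi_square :: "nat \<Rightarrow> real measure" where
  "chi_square d = density lborel (\<lambda>x. ennreal (chi_square_density d x))"

lemma prob_space_chi_square:
  assumes "0 < d"
  shows "prob_space (chi_square d)"
proof (rule prob_spaceI)
  define s where "s = real d / 2"
  define g where "g = (\<lambda>t::real. ennreal (indicator {0..} t * t powr (s - 1) / exp t))"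
  have s: "s > 0" using assms by (simp add: s_def)
  have G: "Gamma s > 0" using s by (rule Gamma_real_pos)
  have [measurable]: "g \<in> borel_measurable borel" unfolding g_def by measurable
  have [measurable]: "chi_square_density d \<in> borel_measurable borel"
    unfolding chi_square_density_def by measurable
  have eq: "ennreal (chi_square_density d x) = ennreal (1 / (2 * Gamma s)) * g (0 + (1 / 2) * x)" if "x \<noteq> 0" for x
  proof (cases "x > 0")
    case True
    have "x powr (s - 1) * exp (- x / 2) / (2 powr s * Gamma s)
        = (1 / (2 * Gamma s)) * ((x / 2) powr (s - 1) / exp (x / 2))"
      using True G by (simp add: powr_divide powr_diff exp_minus field_simps)
    then show ?thesis
      using True G by (simp add: chi_square_density_def g_def ennreal_mult'[symmetric] flip: s_def)
  next
    case False
    with that show ?thesis by (simp add: chi_square_density_def g_def)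
  qed
  have "emeasure (chi_square d) (space (chi_square d)) = (\<integral>\<^sup>+x. ennreal (chi_square_density d x) \<partial>lborel)"
    by (simp add: chi_square_def emeasure_density)
  also have "\<dots> = (\<integral>\<^sup>+x. ennreal (1 / (2 * Gamma s)) * g (0 + (1 / 2) * x) \<partial>lborel)"
    by (intro nn_integral_cong_AE eventually_mono[OF AE_lborel_singleton[of 0]] eq)
  also have "\<dots> = ennreal (1 / (2 * Gamma s)) * (\<integral>\<^sup>+x. g (0 + (1 / 2) * x) \<partial>lborel)"
    by (rule nn_integral_cmult) simp
  also have "(\<integral>\<^sup>+x. g (0 + (1 / 2) * x) \<partial>lborel) = ennreal 2 * (ennreal (1 / 2) * (\<integral>\<^sup>+x. g (0 + (1 / 2) * x) \<partial>lborel))"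
    by (simp add: mult.assoc[symmetric] ennreal_mult'[symmetric] del: ennreal_half ennreal_numeral)
  also have "ennreal (1 / 2) * (\<integral>\<^sup>+x. g (0 + (1 / 2) * x) \<partial>lborel) = (\<integral>\<^sup>+x. g x \<partial>lborel)"
    using nn_integral_real_affine[of g "1 / 2" 0] by simp
  also have "(\<integral>\<^sup>+x. g x \<partial>lborel) = ennreal (Gamma s)"
    unfolding g_def by (rule Gamma_conv_nn_integral_real[OF s, symmetric])
  also have "ennreal (1 / (2 * Gamma s)) * (ennreal 2 * ennreal (Gamma s)) = 1"
    using G by (simp add: ennreal_mult'[symmetric] del: ennreal_numeral)
  finally show "emeasure (chi_square d) (space (chi_square d)) = 1" .
qed

definition Wilks_theorem_holds ::
  "'a measure set \<Rightarrow> (nat \<Rightarrow> 'a \<Rightarrow> real) \<Rightarrow> ('a measure \<Rightarrow> real \<Rightarrow> real) \<Rightarrow> nat \<Rightarrow> 'a measure \<Rightarrow> bool" where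
  "Wilks_theorem_holds \<Q> X f d P \<longleftrightarrow>
     weak_conv (\<lambda>N t. inner_prob P {\<omega> \<in> space P. 2 * divergence \<Q> f N (obs X N \<omega>) P \<le> ereal t})
       (cdf (chi_square d))"

text \<open>
  The conditional expectation of \<open>\<xi>\<close> given a sub-\<open>\<sigma>\<close>-algebra \<open>F\<close> is defined, and finite, as soon as
  \<open>E[|\<xi>| | F] < \<infinity>\<close> almost surely; this includes all integrable \<open>\<xi>\<close>.
\<close>

definition has_cond_exp :: "'a measure \<Rightarrow> 'a measure \<Rightarrow> ('a \<Rightarrow> real) \<Rightarrow> bool" where
  "has_cond_exp M F \<xi> \<longleftrightarrow>
     \<xi> \<in> borel_measurable M \<and> (AE \<omega> in M. nn_cond_exp M F (\<lambda>\<omega>. ennreal \<bar>\<xi> \<omega>\<bar>) \<omega> < \<infinity>)"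

definition cond_exp_version :: "'a measure \<Rightarrow> 'a measure \<Rightarrow> ('a \<Rightarrow> real) \<Rightarrow> ('a \<Rightarrow> real) \<Rightarrow> bool" where
  "cond_exp_version M F \<xi> Y \<longleftrightarrow> Y \<in> borel_measurable F \<and> (AE \<omega> in M. Y \<omega> = real_cond_exp M F \<xi> \<omega>)"

lemma (in sigma_finite_subalgebra) has_cond_exp_integrable:
  assumes "integrable M \<xi>"
  shows "has_cond_exp M F \<xi>"
proof -
  have [measurable]: "\<xi> \<in> borel_measurable M"
    using assms by simp
  have "(\<integral>\<^sup>+\<omega>. nn_cond_exp M F (\<lambda>\<omega>. ennreal \<bar>\<xi> \<omega>\<bar>) \<omega> \<partial>M) = (\<integral>\<^sup>+\<omega>. ennreal \<bar>\<xi> \<omega>\<bar> \<partial>M)"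
    using nn_cond_exp_intg[of "\<lambda>_. 1" "\<lambda>\<omega>. ennreal \<bar>\<xi> \<omega>\<bar>"] by simp
  also have "\<dots> < \<infinity>"
    using assms by (simp add: integrable_iff_bounded)
  finally have "AE \<omega> in M. nn_cond_exp M F (\<lambda>\<omega>. ennreal \<bar>\<xi> \<omega>\<bar>) \<omega> \<noteq> \<infinity>"
    by (intro nn_integral_noteq_infinite) auto
  then show ?thesis
    by (simp add: has_cond_exp_def less_top)
qed

definition admissible ::
  "'a measure \<Rightarrow> 'a measure set \<Rightarrow> (nat \<Rightarrow> 'a \<Rightarrow> real) \<Rightarrow> nat \<Rightarrow> ('a \<Rightarrow> real) set" where
  "admissible \<Omega> \<Q> X N = {\<xi>. \<forall>Q\<in>\<Q>. has_cond_exp Q (obs_algebra \<Omega> X N) \<xi>}"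

text \<open>
  \<open>E Q N \<xi>\<close> is the chosen version of \<open>E\<^sub>Q[\<xi> | X\<^sub>1, \<dots>, X\<^sub>N]\<close>. The version \<open>real_cond_exp\<close> of the
  library is one such choice.
\<close>

definition cond_exp_choice ::
  "'a measure \<Rightarrow> 'a measure set \<Rightarrow> (nat \<Rightarrow> 'a \<Rightarrow> real) \<Rightarrow>
   ('a measure \<Rightarrow> nat \<Rightarrow> ('a \<Rightarrow> real) \<Rightarrow> 'a \<Rightarrow> real) \<Rightarrow> bool" where
  "cond_exp_choice \<Omega> \<Q> X E \<longleftrightarrow>
     (\<forall>Q\<in>\<Q>. \<forall>N. \<forall>\<xi>\<in>admissible \<Omega> \<Q> X N.
        cond_exp_version Q (obs_algebra \<Omega> X N) \<xi> (E Q N \<xi>) \<and>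
        (\<forall>\<omega>\<in>space \<Omega>. E Q N (\<lambda>\<omega>. - \<xi> \<omega>) \<omega> = - E Q N \<xi> \<omega>))"

lemma cond_exp_choice_real_cond_exp:
  "cond_exp_choice \<Omega> \<Q> X (\<lambda>Q N. real_cond_exp Q (obs_algebra \<Omega> X N))"
  by (simp add: cond_exp_choice_def cond_exp_version_def real_cond_exp_def)

text \<open>\<open>x\<^sup>\<infinity>\<close>, for arguments \<open>x \<ge> 0\<close>.\<close>

definition pow_infty :: "ereal \<Rightarrow> ereal" where
  "pow_infty x = (if x \<le> 1 then 0 else \<infinity>)"

definition DR_expectation_infty ::
  "'a measure set \<Rightarrow> (nat \<Rightarrow> 'a \<Rightarrow> real) \<Rightarrow> ('a measure \<Rightarrow> real \<Rightarrow> real) \<Rightarrow>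
   ('a measure \<Rightarrow> nat \<Rightarrow> ('a \<Rightarrow> real) \<Rightarrow> 'a \<Rightarrow> real) \<Rightarrow> real \<Rightarrow> nat \<Rightarrow> ('a \<Rightarrow> real) \<Rightarrow> 'a \<Rightarrow> ereal" where
  "DR_expectation_infty \<Q> X f E k N \<xi> \<omega> =
     (SUP Q\<in>\<Q>. ereal (E Q N \<xi> \<omega>) - pow_infty (ereal (1 / k) * divergence \<Q> f N (obs X N \<omega>) Q))"

definition DR_interval ::
  "'a measure set \<Rightarrow> (nat \<Rightarrow> 'a \<Rightarrow> real) \<Rightarrow> ('a measure \<Rightarrow> real \<Rightarrow> real) \<Rightarrow>
   ('a measure \<Rightarrow> nat \<Rightarrow> ('a \<Rightarrow> real) \<Rightarrow> 'a \<Rightarrow> real) \<Rightarrow> real \<Rightarrow> nat \<Rightarrow> ('a \<Rightarrow> real) \<Rightarrow> 'a \<Rightarrow> ereal set" where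
  "DR_interval \<Q> X f E k N \<xi> \<omega> =
     {- DR_expectation_infty \<Q> X f E k N (\<lambda>\<omega>. - \<xi> \<omega>) \<omega> .. DR_expectation_infty \<Q> X f E k N \<xi> \<omega>}"

definition likely_models ::
  "'a measure set \<Rightarrow> ('a measure \<Rightarrow> real \<Rightarrow> real) \<Rightarrow> real \<Rightarrow> nat \<Rightarrow> (nat \<Rightarrow> real) \<Rightarrow> 'a measure set" where
  "likely_models \<Q> f k N x = {Q \<in> \<Q>. relative_likelihood \<Q> f N x Q \<ge> ereal (exp (- k))}"

end

theory Submission
  imports Defs
begin

text \<open>
  The penalty \<open>(\<alpha>(Q) / k)\<^sup>\<infinity>\<close> vanishes if \<open>\<alpha>(Q) \<le> k\<close>, that is, if the relative likelihood
  of \<open>Q\<close> is at least \<open>e\<^sup>-\<^sup>k\<close>, and excludes \<open>Q\<close> from the supremum otherwise. Hence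
  \<open>2\<alpha>(P) \<le> 2k\<close> puts \<open>P\<close> itself among the models over which the endpoints range, for all \<open>\<xi>\<close>
  at once, and by Wilks' theorem this event has asymptotic probability \<open>F(2k)\<close>, as the distribution
  function \<open>F\<close> is continuous.
\<close>

text \<open>Both sides unfold to a bound on a supremum, which holds iff it holds for each R in \<Q>.
  So only individual likelihoods are compared through the logarithm, and it never has to be
  exchanged with the supremum.\<close>

lemma divergence_le_iff:
  assumes nonneg: "\<And>R t. R \<in> \<Q> \<Longrightarrow> 0 \<le> f R t" and Q: "Q \<in> \<Q>"
  shows "divergence \<Q> f N x Q \<le> ereal k \<longleftrightarrow> relative_likelihood \<Q> f N x Q \<ge> ereal (exp (- k))"
proof (cases "likelihood f N x Q = 0")
  \<comment> \<open>Both sides are false: the divergence is \<infinity> because \<infinity> absorbs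
    any summand, and the relative likelihood is 0 whatever the denominator.\<close>
  case True
  then show ?thesis
    by (simp add: divergence_def relative_likelihood_def log_likelihood_def zero_ereal_def[symmetric])
next
  case False
  define l where "l = likelihood f N x"
  define S where "S = (SUP R\<in>\<Q>. ereal (l R))"
  have l_nonneg: "0 \<le> l R" if "R \<in> \<Q>" for R
    unfolding l_def likelihood_def using nonneg[OF that] by (intro prod_nonneg) auto
  have lQ: "0 < l Q"
    using l_nonneg[OF Q] False by (simp add: l_def)
  \<comment> \<open>\<open>k + ln (l Q)\<close> is the bound left for each log-likelihood once
    \<open>- ln (l Q)\<close> is moved to the right-hand side.\<close>
  have log_le: "log_likelihood f N x R \<le> ereal (k + ln (l Q)) \<longleftrightarrow> l R \<le> exp k * l Q"
    if R: "R \<in> \<Q>" for R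
  proof (cases "l R = 0")
    case True
    then show ?thesis using lQ by (simp add: log_likelihood_def l_def)
  next
    case False
    then have "0 < l R" using l_nonneg[OF R] by simp
    moreover have "k + ln (l Q) = ln (exp k * l Q)" using lQ by (simp add: ln_mult)
    ultimately show ?thesis using lQ by (simp add: log_likelihood_def flip: l_def)
  qed
  have "divergence \<Q> f N x Q = ereal (- ln (l Q)) + (SUP R\<in>\<Q>. log_likelihood f N x R)"
    using False by (simp add: divergence_def log_likelihood_def l_def)
  then have "divergence \<Q> f N x Q \<le> ereal k
      \<longleftrightarrow> (SUP R\<in>\<Q>. log_likelihood f N x R) \<le> ereal (k + ln (l Q))"
    by (cases "SUP R\<in>\<Q>. log_likelihood f N x R") auto
  also have "\<dots> \<longleftrightarrow> S \<le> ereal (exp k * l Q)"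
    unfolding S_def SUP_le_iff by (simp add: log_le)
  also have "\<dots> \<longleftrightarrow> ereal (exp (- k)) \<le> ereal (l Q) / S"
  proof -
    \<comment> \<open>This makes S positive, so a finite S can be cleared from the denominator. For
      S = \<infinity>, an unbounded likelihood, the quotient is 0 and both sides fail.\<close>
    have "ereal (l Q) \<le> S" unfolding S_def by (rule SUP_upper[OF Q])
    with lQ show ?thesis
      by (cases S) (auto simp: exp_minus field_simps)
  qed
  finally show ?thesis
    by (simp add: relative_likelihood_def S_def l_def)
qed

lemma pow_infty_scaled:
  assumes "0 < k"
  shows "pow_infty (ereal (1 / k) * a) = (if a \<le> ereal k then 0 else \<infinity>)"
  using assms by (cases a) (auto simp: pow_infty_def field_simps)

text \<open>Since \<open>E Q N \<xi> \<omega>\<close> is finite, an infinite penalty turns the term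
  into -\<infinity>, which is neutral for suprema in \<open>ereal\<close>, even if no model is
  left.\<close>

lemma DR_expectation_infty_eq_SUP:
  assumes nonneg: "\<And>R t. R \<in> \<Q> \<Longrightarrow> 0 \<le> f R t" and "0 < k"
  shows "DR_expectation_infty \<Q> X f E k N \<xi> \<omega>
      = (SUP Q\<in>likely_models \<Q> f k N (obs X N \<omega>). ereal (E Q N \<xi> \<omega>))"
    (is "_ = (SUP Q\<in>?A. _)")
proof -
  have penalized: "ereal (E Q N \<xi> \<omega>) - pow_infty (ereal (1 / k) * divergence \<Q> f N (obs X N \<omega>) Q)
      = (if Q \<in> ?A then ereal (E Q N \<xi> \<omega>) else -\<infinity>)" if "Q \<in> \<Q>" for Q
    using that divergence_le_iff[of \<Q> f Q N "obs X N \<omega>" k, OF nonneg that]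
    by (simp add: pow_infty_scaled[OF \<open>0 < k\<close>] likely_models_def)
  show ?thesis
    unfolding DR_expectation_infty_def
  proof (rule antisym)
    show "(SUP Q\<in>\<Q>. ereal (E Q N \<xi> \<omega>) - pow_infty (ereal (1 / k) * divergence \<Q> f N (obs X N \<omega>) Q))
        \<le> (SUP Q\<in>?A. ereal (E Q N \<xi> \<omega>))"
      by (rule SUP_least) (auto simp: penalized intro: SUP_upper)
    show "(SUP Q\<in>?A. ereal (E Q N \<xi> \<omega>))
        \<le> (SUP Q\<in>\<Q>. ereal (E Q N \<xi> \<omega>) - pow_infty (ereal (1 / k) * divergence \<Q> f N (obs X N \<omega>) Q))"
    proof (rule SUP_least)
      fix Q assume A: "Q \<in> ?A"
      then have "Q \<in> \<Q>" by (simp add: likely_models_def)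
      with A show "ereal (E Q N \<xi> \<omega>)
          \<le> (SUP Q\<in>\<Q>. ereal (E Q N \<xi> \<omega>) - pow_infty (ereal (1 / k) * divergence \<Q> f N (obs X N \<omega>) Q))"
        by (intro SUP_upper2[of Q]) (simp_all add: penalized)
    qed
  qed
qed

text \<open>The chosen versions are odd in \<xi> at every point of the space, so the sign moves
  through the supremum without an exceptional null set, which would depend on Q and \<xi>.\<close>

lemma uminus_DR_expectation_infty_uminus:
  assumes nonneg: "\<And>R t. R \<in> \<Q> \<Longrightarrow> 0 \<le> f R t" and "0 < k"
    and E: "cond_exp_choice \<Omega> \<Q> X E" and "\<xi> \<in> admissible \<Omega> \<Q> X N" "\<omega> \<in> space \<Omega>"
  shows "- DR_expectation_infty \<Q> X f E k N (\<lambda>\<omega>. - \<xi> \<omega>) \<omega>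
      = (INF Q\<in>likely_models \<Q> f k N (obs X N \<omega>). ereal (E Q N \<xi> \<omega>))"
proof -
  have "E Q N (\<lambda>\<omega>. - \<xi> \<omega>) \<omega> = - E Q N \<xi> \<omega>" if "Q \<in> likely_models \<Q> f k N (obs X N \<omega>)" for Q
    using that assms(3-5) by (auto simp: cond_exp_choice_def likely_models_def)
  then have "(SUP Q\<in>likely_models \<Q> f k N (obs X N \<omega>). ereal (E Q N (\<lambda>\<omega>. - \<xi> \<omega>) \<omega>))
      = (SUP Q\<in>likely_models \<Q> f k N (obs X N \<omega>). - ereal (E Q N \<xi> \<omega>))"
    by (intro SUP_cong) auto
  with DR_expectation_infty_eq_SUP[of \<Q> f k X E N "\<lambda>\<omega>. - \<xi> \<omega>" \<omega>] nonneg \<open>0 < k\<close>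
  have "DR_expectation_infty \<Q> X f E k N (\<lambda>\<omega>. - \<xi> \<omega>) \<omega>
      = (SUP Q\<in>likely_models \<Q> f k N (obs X N \<omega>). - ereal (E Q N \<xi> \<omega>))"
    by simp
  then show ?thesis
    unfolding ereal_SUP_uminus_eq by simp
qed

text \<open>No measurability of A or B is assumed, so this applies to the event quantified over all
  \<xi>.\<close>

lemma inner_prob_mono:
  assumes "finite_measure M" and "A \<subseteq> B"
  shows "inner_prob M A \<le> inner_prob M B"
proof -
  interpret finite_measure M by fact
  show ?thesis
    unfolding inner_prob_def
  proof (rule cSUP_subset_mono)
    show "{C \<in> sets M. C \<subseteq> A} \<noteq> {}" by auto
    show "bdd_above (measure M ` {C \<in> sets M. C \<subseteq> B})"
      by (rule bdd_aboveI2[where M = "measure M (space M)"]) (rule bounded_measure)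
  qed (use \<open>A \<subseteq> B\<close> in auto)
qed

text \<open>Having a Lebesgue density, the distribution has no atoms. Weak convergence yields limits
  only at continuity points, and the limit is wanted at 2k.\<close>

lemma isCont_cdf_chi_square:
  assumes "0 < d"
  shows "isCont (cdf (chi_square d)) x"
proof -
  interpret prob_space "chi_square d" by (rule prob_space_chi_square[OF assms])
  interpret real_distribution "chi_square d" by standard (simp_all add: chi_square_def)
  have [measurable]: "chi_square_density d \<in> borel_measurable borel"
    unfolding chi_square_density_def by measurable
  have "absolutely_continuous lborel (chi_square d)"
    unfolding chi_square_def by (rule absolutely_continuousI_density) simp
  then have "{x} \<in> null_sets (chi_square d)"
    unfolding absolutely_continuous_def by (rule subsetD) (rule null_setsI; simp)
  then show ?thesis
    unfolding isCont_cdf by (simp add: measure_eq_0_null_sets)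
qed

theorem theorem6:
  fixes \<Omega> :: "'a measure" and \<mu> :: "real measure" and \<Q> :: "'a measure set"
    and param :: "'a measure \<Rightarrow> 'p::euclidean_space"
    and X :: "nat \<Rightarrow> 'a \<Rightarrow> real" and f :: "'a measure \<Rightarrow> real \<Rightarrow> real"
    and Qhat :: "nat \<Rightarrow> (nat \<Rightarrow> real) \<Rightarrow> 'a measure"
    and E :: "'a measure \<Rightarrow> nat \<Rightarrow> ('a \<Rightarrow> real) \<Rightarrow> 'a \<Rightarrow> real"
    and d :: nat and k :: real
  assumes "iid_family \<Omega> \<mu> \<Q> param X f"
    and "cond_exp_choice \<Omega> \<Q> X E"
    and "consistent_MLE \<Q> param X f Qhat"
    and "0 < d"
    and "\<And>P. P \<in> \<Q> \<Longrightarrow> Wilks_theorem_holds \<Q> X f d P"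
    and "0 < k"
  shows "(\<forall>N. \<forall>\<xi>\<in>admissible \<Omega> \<Q> X N. \<forall>\<omega>\<in>space \<Omega>.
           - DR_expectation_infty \<Q> X f E k N (\<lambda>\<omega>. - \<xi> \<omega>) \<omega>
             = (INF Q\<in>likely_models \<Q> f k N (obs X N \<omega>). ereal (E Q N \<xi> \<omega>)) \<and>
           DR_expectation_infty \<Q> X f E k N \<xi> \<omega>
             = (SUP Q\<in>likely_models \<Q> f k N (obs X N \<omega>). ereal (E Q N \<xi> \<omega>))) \<and>
         (\<forall>P\<in>\<Q>. liminf (\<lambda>N. ereal (inner_prob P
            {\<omega> \<in> space P. \<forall>\<xi>\<in>admissible \<Omega> \<Q> X N. ereal (E P N \<xi> \<omega>) \<in> DR_interval \<Q> X f E k N \<xi> \<omega>}))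
           \<ge> ereal (cdf (chi_square d) (2 * k)))"
proof -
  interpret iid_family \<Omega> \<mu> \<Q> param X f by fact
  have lower: "- DR_expectation_infty \<Q> X f E k N (\<lambda>\<omega>. - \<xi> \<omega>) \<omega>
      = (INF Q\<in>likely_models \<Q> f k N (obs X N \<omega>). ereal (E Q N \<xi> \<omega>))"
    if "\<xi> \<in> admissible \<Omega> \<Q> X N" "\<omega> \<in> space \<Omega>" for N \<xi> \<omega>
    by (rule uminus_DR_expectation_infty_uminus[OF density_nonneg \<open>0 < k\<close> assms(2) that])
  have upper: "DR_expectation_infty \<Q> X f E k N \<xi> \<omega>
      = (SUP Q\<in>likely_models \<Q> f k N (obs X N \<omega>). ereal (E Q N \<xi> \<omega>))" for N \<xi> \<omega>
    by (rule DR_expectation_infty_eq_SUP[OF density_nonneg \<open>0 < k\<close>])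
  have "liminf (\<lambda>N. ereal (inner_prob P
      {\<omega> \<in> space P. \<forall>\<xi>\<in>admissible \<Omega> \<Q> X N. ereal (E P N \<xi> \<omega>) \<in> DR_interval \<Q> X f E k N \<xi> \<omega>}))
    \<ge> ereal (cdf (chi_square d) (2 * k))" (is "liminf (\<lambda>N. ereal (inner_prob P (?B N))) \<ge> _")
    if P: "P \<in> \<Q>" for P
  proof -
    define A where
      "A N = {\<omega> \<in> space P. 2 * divergence \<Q> f N (obs X N \<omega>) P \<le> ereal (2 * k)}" for N
    interpret P: prob_space P by (rule prob_space[OF P])
    have sub: "A N \<subseteq> ?B N" for N
    proof
      fix \<omega> assume \<omega>: "\<omega> \<in> A N"
      \<comment> \<open>The event lives on \<open>space P\<close>, the sign convention for the
        versions on \<open>space \<Omega>\<close>.\<close>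
      have space: "\<omega> \<in> space \<Omega>"
        using \<omega> sets_eq_imp_space_eq[OF sets_eq[OF P]] by (simp add: A_def)
      have "divergence \<Q> f N (obs X N \<omega>) P \<le> ereal k"
        using \<omega> by (cases "divergence \<Q> f N (obs X N \<omega>) P") (auto simp: A_def)
      then have "P \<in> likely_models \<Q> f k N (obs X N \<omega>)"
        using P divergence_le_iff[of \<Q> f P, OF density_nonneg P] by (simp add: likely_models_def)
      \<comment> \<open>\<open>lower\<close> is rewritten before \<open>upper\<close>, which would
        otherwise turn the lower endpoint into a negated supremum for -\<xi>.\<close>
      then have "ereal (E P N \<xi> \<omega>) \<in> DR_interval \<Q> X f E k N \<xi> \<omega>"
        if "\<xi> \<in> admissible \<Omega> \<Q> X N" for \<xi>
        unfolding DR_interval_def lower[OF that space] unfolding upper by (auto intro: INF_lower SUP_upper)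
      then show "\<omega> \<in> ?B N" using \<omega> by (simp add: A_def)
    qed
    have "(\<lambda>N. inner_prob P (A N)) \<longlonglongrightarrow> cdf (chi_square d) (2 * k)"
      using assms(5)[OF P] isCont_cdf_chi_square[OF \<open>0 < d\<close>, of "2 * k"]
      by (simp add: Wilks_theorem_holds_def weak_conv_def A_def)
    then have "ereal (cdf (chi_square d) (2 * k)) = liminf (\<lambda>N. ereal (inner_prob P (A N)))"
      by (intro lim_imp_Liminf[symmetric]) auto
    also have "\<dots> \<le> liminf (\<lambda>N. ereal (inner_prob P (?B N)))"
      using inner_prob_mono[OF P.finite_measure_axioms sub] by (intro Liminf_mono) auto
    finally show ?thesis .
  qed
  with lower upper show ?thesis by blast
qed

end
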